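(* Let $V$ be a finite set and let $\mathbf{X}=\{X_v\}_{v\in V}$ be a random vector such that $[\mathbf{X}]$ is closed under composition and under dual decomposable transitivity. If the bidirected graph $\mathcal{G}_{bi}(\mathbf{X})$ is a disjoint union of trees, then $[\mathbf{X}]^{\rceil}=[\mathcal{G}_{bi}(\mathbf{X})]$, i.e. $[\mathbf{X}]$ is both bidirected global Markov and bidirected faithful with respect to $\mathcal{G}_{bi}(\mathbf{X})$.
   Context: For a finite set $V$, $\mathcal{T}(V)$ is the set of all triples $(A,B|C)$ with $A,B,C\subseteq V$ pairwise disjoint and $A,B$ nonempty ($C$ may be empty). A relation is a subset of $\mathcal{T}(V)$. Juxtaposition denotes union ($BC=B\cup C$), lowercase letters denote elements of $V$ identified with singletons, and $ab=\{a,b\}$. For a random vector $\mathbf{X}$ indexed by $V$, with subvectors $\mathbf{X}_A=\{X_a\}_{a\in A}$, the conditional independence structure is $[\mathbf{X}]=\{(A,B|C)\in\mathcal{T}(V):\mathbf{X}_A\text{ is conditionally independent of }\mathbf{X}_B\text{ given }\mathbf{X}_C\}$ (marginal independence when $C=\emptyset$). The dual of a relation $\mathcal{L}$ is $\mathcal{L}^{\rceil}=\{(A,B|C)\in\mathcal{T}(V):(A,B|V\setminus ABC)\in\mathcal{L}\}$. A relation $\mathcal{L}$ is closed under composition if for all pairwise disjoint $A,B,C,S\subseteq V$ with $A,B,C$ nonempty: $(A,B|S),(A,C|S)\in\mathcal{L}$ implies $(A,BC|S)\in\mathcal{L}$. A relation $\mathcal{L}$ is closed under dual decomposable transitivity if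 for all distinct elements $a,c,e\in V$ and all sets $B,D\subseteq V$ with $\{a\},B,\{c\},D,\{e\}$ pairwise disjoint: $(aB,De|V\setminus aBcDe)\in\mathcal{L}$ and $(a,e|V\setminus aBDe)\in\mathcal{L}$ together imply $(a,c|V\setminus aBc)\in\mathcal{L}$ or $(c,e|V\setminus cDe)\in\mathcal{L}$. The bidirected graph $\mathcal{G}_{bi}(\mathbf{X})$ is the graph on $V$ in which distinct $a,b$ are non-adjacent if and only if $(a,b|\emptyset)\in[\mathbf{X}]$, i.e. $X_a$ and $X_b$ are independent. For a graph $\mathcal{G}$ on $V$ and pairwise disjoint $A,B,S\subseteq V$, write $A\perp_{\mathcal{G}}B|S$ if for all $a\in A,b\in B$ every path from $a$ to $b$ in $\mathcal{G}$ contains an element of $S$; $[\mathcal{G}]=\{(A,B|S)\in\mathcal{T}(V):A\perp_{\mathcal{G}}B|S\}$. A relation $\mathcal{L}$ is bidirected global Markov with respect to $\mathcal{G}$ if $[\mathcal{G}]^{\rceil}\subseteq\mathcal{L}$, and bidirected faithful to $\mathcal{G}$ if $\mathcal{L}^{\rceil}\subseteq[\mathcal{G}]$. *)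

theory Defs
  imports "HOL-Probability.Probability" "Graph_Theory.Graph_Theory"
begin

section \<open>Relations on triples\<close>

text \<open>The triple \<open>(A, B | C)\<close> is encoded as \<open>(A, B, C)\<close>.\<close>

type_synonym 'v relation = "('v set \<times> 'v set \<times> 'v set) set"

definition triples :: "'v set \<Rightarrow> 'v relation" where
  "triples V = {(A, B, C). A \<subseteq> V \<and> B \<subseteq> V \<and> C \<subseteq> V \<and> A \<noteq> {} \<and> B \<noteq> {} \<and>
     A \<inter> B = {} \<and> A \<inter> C = {} \<and> B \<inter> C = {}}"

definition dual :: "'v set \<Rightarrow> 'v relation \<Rightarrow> 'v relation" where
  "dual V L = {(A, B, C) \<in> triples V. (A, B, V - (A \<union> B \<union> C)) \<in> L}"

definition closed_under_composition :: "'v set \<Rightarrow> 'v relation \<Rightarrow> bool" where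
  "closed_under_composition V L \<longleftrightarrow>
     (\<forall>A B C S. A \<subseteq> V \<longrightarrow> B \<subseteq> V \<longrightarrow> C \<subseteq> V \<longrightarrow> S \<subseteq> V \<longrightarrow>
        A \<noteq> {} \<longrightarrow> B \<noteq> {} \<longrightarrow> C \<noteq> {} \<longrightarrow>
        A \<inter> B = {} \<longrightarrow> A \<inter> C = {} \<longrightarrow> A \<inter> S = {} \<longrightarrow>
        B \<inter> C = {} \<longrightarrow> B \<inter> S = {} \<longrightarrow> C \<inter> S = {} \<longrightarrow>
        (A, B, S) \<in> L \<longrightarrow> (A, C, S) \<in> L \<longrightarrow> (A, B \<union> C, S) \<in> L)"

definition closed_under_dual_decomposable_transitivity :: "'v set \<Rightarrow> 'v relation \<Rightarrow> bool" where
  "closed_under_dual_decomposable_transitivity V L \<longleftrightarrow>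
     (\<forall>a\<in>V. \<forall>c\<in>V. \<forall>e\<in>V. \<forall>B D. B \<subseteq> V \<longrightarrow> D \<subseteq> V \<longrightarrow>
        distinct [a, c, e] \<longrightarrow> B \<inter> {a, c, e} = {} \<longrightarrow> D \<inter> {a, c, e} = {} \<longrightarrow> B \<inter> D = {} \<longrightarrow>
        ({a} \<union> B, D \<union> {e}, V - ({a} \<union> B \<union> {c} \<union> D \<union> {e})) \<in> L \<longrightarrow>
        ({a}, {e}, V - ({a} \<union> B \<union> D \<union> {e})) \<in> L \<longrightarrow>
        ({a}, {c}, V - ({a} \<union> B \<union> {c})) \<in> L \<or> ({c}, {e}, V - ({c} \<union> D \<union> {e})) \<in> L)"


section \<open>Conditional independence\<close>

definition subvector :: "('v \<Rightarrow> 'a \<Rightarrow> 'b) \<Rightarrow> 'v set \<Rightarrow> 'a \<Rightarrow> 'v \<Rightarrow> 'b" where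
  "subvector X A = (\<lambda>\<omega>. \<lambda>a\<in>A. X a \<omega>)"

text \<open>
  The conditional probability \<open>P(E | Z)\<close> of an event is the conditional expectation of its
  indicator given the \<open>\<sigma>\<close>-algebra on \<open>space M\<close> generated by \<open>Z\<close>. Conditional independence is the
  almost sure product rule for conditional probabilities, so no regular conditional distributions
  or densities are required to exist.
\<close>

definition cond_prob_given :: "'a measure \<Rightarrow> 'c measure \<Rightarrow> ('a \<Rightarrow> 'c) \<Rightarrow> 'a set \<Rightarrow> 'a \<Rightarrow> real" where
  "cond_prob_given M MZ Z E = real_cond_exp M (vimage_algebra (space M) Z MZ) (indicator E)"

definition cond_indep_var ::
  "'a measure \<Rightarrow> 'b measure \<Rightarrow> ('a \<Rightarrow> 'b) \<Rightarrow> 'c measure \<Rightarrow> ('a \<Rightarrow> 'c) \<Rightarrow> 'd measure \<Rightarrow> ('a \<Rightarrow> 'd) \<Rightarrow> bool"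
where
  "cond_indep_var M MX X MY Y MZ Z \<longleftrightarrow>
     X \<in> measurable M MX \<and> Y \<in> measurable M MY \<and> Z \<in> measurable M MZ \<and>
     (\<forall>E\<in>sets MX. \<forall>F\<in>sets MY. AE \<omega> in M.
        cond_prob_given M MZ Z ((X -` E \<inter> space M) \<inter> (Y -` F \<inter> space M)) \<omega> =
        cond_prob_given M MZ Z (X -` E \<inter> space M) \<omega> * cond_prob_given M MZ Z (Y -` F \<inter> space M) \<omega>)"

definition ci_structure ::
  "'a measure \<Rightarrow> ('v \<Rightarrow> 'b measure) \<Rightarrow> 'v set \<Rightarrow> ('v \<Rightarrow> 'a \<Rightarrow> 'b) \<Rightarrow> 'v relation" where
  "ci_structure M N V X = {(A, B, C) \<in> triples V.
     cond_indep_var M (Pi\<^sub>M A N) (subvector X A) (Pi\<^sub>M B N) (subvector X B)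
       (Pi\<^sub>M C N) (subvector X C)}"

text \<open>Conditioning on the empty subvector is marginal independence.\<close>

lemma (in prob_space) cond_prob_given_empty:
  assumes E: "E \<in> events"
  shows "AE \<omega> in M. cond_prob_given M (Pi\<^sub>M {} N) (subvector X {}) E \<omega> = prob E"
proof -
  let ?F = "vimage_algebra (space M) (subvector X {}) (Pi\<^sub>M {} N)"
  have Fs: "sets ?F = {{}, space M}"
  proof (subst sets_vimage_algebra2)
    show "subvector X {} \<in> space M \<rightarrow> space (Pi\<^sub>M {} N)"
      by (auto simp: subvector_def space_PiM_empty restrict_def)
    have "{subvector X {} -` A \<inter> space M |A. A \<in> {{}, {\<lambda>k. undefined}}} = {{}, space M}"
      by (auto simp: subvector_def restrict_def)
    then show "{subvector X {} -` A \<inter> space M |A. A \<in> sets (Pi\<^sub>M {} N)} = {{}, space M}"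
      by (simp add: sets_PiM_empty)
  qed
  have sub: "subalgebra M ?F"
    unfolding subalgebra_def Fs by auto
  interpret finite_measure_subalgebra M ?F
    by unfold_locales (fact sub)
  have "AE \<omega> in M. real_cond_exp M ?F (indicator E) \<omega> = prob E"
  proof (rule real_cond_exp_charact)
    fix A assume "A \<in> sets ?F"
    then show "(\<integral>x\<in>A. indicator E x \<partial>M) = (\<integral>x\<in>A. prob E \<partial>M)"
      using E by (auto simp: Fs set_lebesgue_integral_def prob_space
          simp flip: indicator_inter_arith Bochner_Integration.integral_mult_left
          intro!: Bochner_Integration.integral_cong)
  qed (use E in \<open>auto simp: integrable_real_indicator less_top[symmetric]\<close>)
  then show ?thesis
    by (simp add: cond_prob_given_def)
qed

lemma (in prob_space) cond_indep_var_empty_iff_indep_var: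
  "cond_indep_var M MX Y MY Z (Pi\<^sub>M {} N) (subvector X {}) \<longleftrightarrow> indep_var MX Y MY Z"
proof (cases "random_variable MX Y \<and> random_variable MY Z")
  case True
  then have Y: "random_variable MX Y" and Z: "random_variable MY Z" by auto
  have S: "subvector X {} \<in> measurable M (Pi\<^sub>M {} N)"
    unfolding subvector_def by (rule measurable_restrict) simp
  have "(AE \<omega> in M. cond_prob_given M (Pi\<^sub>M {} N) (subvector X {})
            ((Y -` E \<inter> space M) \<inter> (Z -` F \<inter> space M)) \<omega> =
          cond_prob_given M (Pi\<^sub>M {} N) (subvector X {}) (Y -` E \<inter> space M) \<omega> *
          cond_prob_given M (Pi\<^sub>M {} N) (subvector X {}) (Z -` F \<inter> space M) \<omega>) \<longleftrightarrow>
        prob ((Y -` E \<inter> space M) \<inter> (Z -` F \<inter> space M)) =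
          prob (Y -` E \<inter> space M) * prob (Z -` F \<inter> space M)" (is "?L \<longleftrightarrow> ?R")
    if "E \<in> sets MX" "F \<in> sets MY" for E F
  proof -
    have e: "Y -` E \<inter> space M \<in> events" "Z -` F \<inter> space M \<in> events"
      using that Y Z by (auto intro: measurable_sets)
    then have "(Y -` E \<inter> space M) \<inter> (Z -` F \<inter> space M) \<in> events" by auto
    note * = cond_prob_given_empty[OF this, of N X] cond_prob_given_empty[OF e(1), of N X]
      cond_prob_given_empty[OF e(2), of N X]
    have "?L \<longleftrightarrow> (AE \<omega> in M. ?R)"
      by (intro eventually_subst) (use * in eventually_elim, simp)
    then show ?thesis by simp
  qed
  moreover have "indep_var MX Y MY Z \<longleftrightarrow> (\<forall>E\<in>sets MX. \<forall>F\<in>sets MY.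
        prob ((Y -` E \<inter> space M) \<inter> (Z -` F \<inter> space M)) =
          prob (Y -` E \<inter> space M) * prob (Z -` F \<inter> space M))"
  proof -
    let ?A = "{Y -` A \<inter> space M |A. A \<in> sets MX}" and ?B = "{Z -` A \<inter> space M |A. A \<in> sets MY}"
    have "sigma_sets (space M) ?A = ?A"
      using sets_vimage_algebra[of "space M" Y MX] sets_vimage_algebra2[of Y "space M" MX]
        measurable_space[OF Y] by auto
    moreover have "sigma_sets (space M) ?B = ?B"
      using sets_vimage_algebra[of "space M" Z MY] sets_vimage_algebra2[of Z "space M" MY]
        measurable_space[OF Z] by auto
    moreover have "?A \<subseteq> events" "?B \<subseteq> events"
      using Y Z by (auto intro: measurable_sets)
    ultimately show ?thesis
      using Y Z unfolding indep_var_eq indep_sets2_eq by (simp, blast)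
  qed
  ultimately show ?thesis
    using Y Z S unfolding cond_indep_var_def by simp
next
  case False
  then show ?thesis by (auto simp: cond_indep_var_def indep_var_eq)
qed


section \<open>Graphs\<close>

text \<open>
  A finite simple graph is a \<open>pair_graph\<close>: an irreflexive symmetric set of arcs, both orientations
  of every edge being present. The library's \<open>forest\<close> and \<open>tree\<close> are notions for directed graphs,
  under which the walk \<open>u, v, u\<close> along one edge is already a cycle, so undirected cycles (at least
  three vertices) are used here.
\<close>

definition undirected_cycle :: "'v pair_pre_digraph \<Rightarrow> 'v list \<Rightarrow> bool" where
  "undirected_cycle G p \<longleftrightarrow>
     vpath p (with_proj G) \<and> length p \<ge> 3 \<and> (last p, hd p) \<in> parcs G"

definition undirected_tree :: "'v pair_pre_digraph \<Rightarrow> bool" where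
  "undirected_tree T \<longleftrightarrow>
     pair_graph T \<and> Digraph_Component.connected (with_proj T) \<and> \<not> (\<exists>p. undirected_cycle T p)"

definition disjoint_union_of_trees :: "'v pair_pre_digraph \<Rightarrow> bool" where
  "disjoint_union_of_trees G \<longleftrightarrow>
     (\<exists>\<T>. (\<forall>T\<in>\<T>. undirected_tree T) \<and>
          (\<forall>T\<in>\<T>. \<forall>T'\<in>\<T>. T \<noteq> T' \<longrightarrow> pverts T \<inter> pverts T' = {}) \<and>
          pverts G = (\<Union>T\<in>\<T>. pverts T) \<and> parcs G = (\<Union>T\<in>\<T>. parcs T))"

definition separates :: "'v pair_pre_digraph \<Rightarrow> 'v set \<Rightarrow> 'v set \<Rightarrow> 'v set \<Rightarrow> bool" where
  "separates G A B S \<longleftrightarrow>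
     (\<forall>a\<in>A. \<forall>b\<in>B. \<forall>p. vpath p (with_proj G) \<and> hd p = a \<and> last p = b \<longrightarrow> set p \<inter> S \<noteq> {})"

definition graph_structure :: "'v pair_pre_digraph \<Rightarrow> 'v relation" where
  "graph_structure G = {(A, B, S) \<in> triples (pverts G). separates G A B S}"

text \<open>
  For \<open>L = ci_structure M N V X\<close> the relation below is symmetric because conditional independence is.
\<close>

definition bidirected_graph :: "'v set \<Rightarrow> 'v relation \<Rightarrow> 'v pair_pre_digraph" where
  "bidirected_graph V L =
     \<lparr> pverts = V, parcs = {(a, b). a \<in> V \<and> b \<in> V \<and> a \<noteq> b \<and> ({a}, {b}, {}) \<notin> L} \<rparr>"

definition bidirected_global_Markov :: "'v pair_pre_digraph \<Rightarrow> 'v relation \<Rightarrow> bool" where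
  "bidirected_global_Markov G L \<longleftrightarrow> dual (pverts G) (graph_structure G) \<subseteq> L"

definition bidirected_faithful :: "'v pair_pre_digraph \<Rightarrow> 'v relation \<Rightarrow> bool" where
  "bidirected_faithful G L \<longleftrightarrow> dual (pverts G) L \<subseteq> graph_structure G"

end

theory Submission
  imports Defs
begin

text \<open>
  Write \<open>A \<bottom> B | S\<close> for conditional independence. In terms of conditional independence the claim says
  that \<open>A \<bottom> B | S\<close> holds exactly when no edge path joins \<open>A\<close> to \<open>B\<close> inside \<open>A \<union> B \<union> S\<close>. Two kinds of
  reasoning suffice. From probability only the semigraphoid rules (symmetry, decomposition, weak
  union, contraction) are needed; they follow once \<open>A \<bottom> B | C\<close> is rephrased as ``the conditional
  probability of an event of \<open>B\<close> given \<open>A \<union> C\<close> is its conditional probability given \<open>C\<close>''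
  (\<open>cond_indep_iff_cond_exp_eq\<close>). From the graph only one property of forests is needed: two distinct
  neighbours of a vertex \<open>c\<close> are not connected once \<open>c\<close> is deleted (\<open>branches_separated\<close>).

  Separation implies independence (\<open>separated_imp_ci\<close>). Composition builds \<open>A' \<bottom> B' | {}\<close> from the missing
  edges between \<open>A'\<close> and \<open>B'\<close>. If no path joins \<open>A\<close> to \<open>B\<close> inside \<open>A \<union> B \<union> S\<close>, then \<open>S\<close> is divided between
  an \<open>A'\<close> containing \<open>A\<close> and a \<open>B'\<close> containing \<open>B\<close> without edges between them, and weak union moves
  the elements of \<open>S\<close> into the condition.

  Independence implies separation (\<open>ci_imp_separated\<close>). Weak union reduces this to two vertices \<open>a\<close>, \<open>e\<close>
  joined by a path with all interior vertices in the condition \<open>S\<close>; the claim is then that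
  \<open>a \<bottom> e | S\<close> fails, by induction on the path.
  For an edge (\<open>edge_imp_not_ci\<close>), split \<open>S\<close> into the part \<open>A'\<close> hanging on \<open>a\<close> and the rest \<open>B'\<close>. The forest
  gives \<open>A' \<bottom> e | {}\<close> and \<open>A' \<union> a \<bottom> B' | {}\<close>, and two contractions then remove \<open>B'\<close> and \<open>A'\<close> from the
  condition of \<open>a \<bottom> e | A' \<union> B'\<close>, leaving \<open>a \<bottom> e | {}\<close>, which contradicts the edge.
  For a longer path (\<open>path_imp_not_ci\<close>), let \<open>c\<close> be its second vertex. Deleting \<open>c\<close> separates \<open>a\<close> from
  \<open>e\<close>, so the vertices outside \<open>S\<close> split into a part \<open>B\<close> on the side of \<open>a\<close> and a part \<open>D\<close> on the other
  side, with \<open>a \<union> B \<bottom> D \<union> e | S - c\<close>. Dual decomposable transitivity turns \<open>a \<bottom> e | S\<close> into an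
  independence between \<open>a\<close> and \<open>c\<close> or between \<open>c\<close> and \<open>e\<close>. In both cases the condition still contains
  the interior of the connecting subpath, which contradicts the edge case or the induction hypothesis.
\<close>

section \<open>Conditional independence of sub-sigma-algebras\<close>

text \<open>
  Equality of two integrals passes to complements and to disjoint countable unions, so by Dynkin's
  lemma it needs to be checked only on an intersection-stable generator.
\<close>

lemma set_integral_eq_on_sigma_sets:
  fixes f g :: "'a \<Rightarrow> real"
  assumes f: "integrable M f" and g: "integrable M g"
    and stable: "Int_stable \<G>" and sub: "\<G> \<subseteq> sets M" and sp: "space M \<in> \<G>"
    and eq: "\<And>A. A \<in> \<G> \<Longrightarrow> (\<integral>x\<in>A. f x \<partial>M) = (\<integral>x\<in>A. g x \<partial>M)"
    and A: "A \<in> sigma_sets (space M) \<G>"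
  shows "(\<integral>x\<in>A. f x \<partial>M) = (\<integral>x\<in>A. g x \<partial>M)"
proof -
  have pow: "\<G> \<subseteq> Pow (space M)"
    using sub sets.sets_into_space by blast
  have meas: "B \<in> sets M" if "B \<in> sigma_sets (space M) \<G>" for B
    using that sets.sigma_sets_subset[OF sub] by auto
  have int: "set_integrable M B f" "set_integrable M B g" if "B \<in> sets M" for B
    using integrable_mult_indicator[OF that f] integrable_mult_indicator[OF that g]
    by (simp_all add: set_integrable_def)
  show ?thesis
    using stable pow A
  proof (induction rule: sigma_sets_induct_disjoint)
    case (basic B)
    then show ?case by (rule eq)
  next
    case empty
    show ?case by (simp add: set_lebesgue_integral_def)
  next
    case (compl B)
    have B: "B \<in> sets M" using compl(1) by (rule meas)
    have split: "(\<integral>x\<in>space M. h x \<partial>M) = (\<integral>x\<in>space M - B. h x \<partial>M) + (\<integral>x\<in>B. h x \<partial>M)"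
      if "\<And>C. C \<in> sets M \<Longrightarrow> set_integrable M C h" for h :: "'a \<Rightarrow> real"
    proof -
      have "(space M - B) \<union> B = space M" using sets.sets_into_space[OF B] by auto
      with set_integral_Un[of "space M - B" B M h] that B show ?thesis by auto
    qed
    show ?case
      using split[of f] split[of g] int compl(2) eq[OF sp] by auto
  next
    case (union B)
    have B: "B i \<in> sets M" for i using union(2) by (auto intro: meas)
    have disj: "i \<noteq> j \<Longrightarrow> B i \<inter> B j = {}" for i j
      using union(1) by (auto simp: disjoint_family_on_def)
    have "(\<integral>x\<in>(\<Union>i. B i). h x \<partial>M) = (\<Sum>i. \<integral>x\<in>B i. h x \<partial>M)"
      if "\<And>C. C \<in> sets M \<Longrightarrow> set_integrable M C h" for h :: "'a \<Rightarrow> real"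
      by (rule lebesgue_integral_countable_add[OF B disj that]) (use B in auto)
    from this[of f] this[of g] show ?case
      using int union(3) by auto
  qed
qed

lemma (in prob_space) subalgebra_is_sigma_finite:
  assumes "subalgebra M F"
  shows "sigma_finite_subalgebra M F"
proof -
  interpret finite_measure_subalgebra M F by unfold_locales (fact assms)
  show ?thesis by unfold_locales
qed

text \<open>
  The product rule is the symmetric form of conditional independence; the right-hand side says that
  learning \<open>F\<close> on top of \<open>H\<close> does not change the prediction of events of \<open>G\<close>, and it is the form in which
  the semigraphoid rules become statements about chains of \<open>\<sigma>\<close>-algebras. For the forward direction the
  product rule determines the integral of \<open>P(B | H)\<close> over every rectangle \<open>A \<inter> C\<close>, and the rectangles
  generate \<open>K\<close>. Conversely, conditioning \<open>A \<inter> B\<close> first on \<open>K\<close> and then on \<open>H\<close> lets the indicator of \<open>A\<close>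
  and afterwards \<open>P(B | H)\<close> be pulled out.
\<close>

lemma (in prob_space) cond_indep_iff_cond_exp_eq:
  assumes F: "subalgebra M F" and G: "subalgebra M G" and H: "subalgebra M H" and K: "subalgebra M K"
    and K_sets: "sets K = sigma_sets (space M) {A \<inter> C |A C. A \<in> sets F \<and> C \<in> sets H}"
  shows "(\<forall>A\<in>sets F. \<forall>B\<in>sets G. AE \<omega> in M.
            real_cond_exp M H (indicator (A \<inter> B)) \<omega> =
            real_cond_exp M H (indicator A) \<omega> * real_cond_exp M H (indicator B) \<omega>) \<longleftrightarrow>
         (\<forall>B\<in>sets G. AE \<omega> in M.
            real_cond_exp M K (indicator B) \<omega> = real_cond_exp M H (indicator B) \<omega>)"
    (is "?product \<longleftrightarrow> ?same")
proof -
  interpret H: sigma_finite_subalgebra M H by (rule subalgebra_is_sigma_finite[OF H])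
  interpret K: sigma_finite_subalgebra M K by (rule subalgebra_is_sigma_finite[OF K])
  let ?P = "\<lambda>B. real_cond_exp M H (indicator B)"
  have mF: "A \<in> events" if "A \<in> sets F" for A using F that by (auto simp: subalgebra_def)
  have mG: "A \<in> events" if "A \<in> sets G" for A using G that by (auto simp: subalgebra_def)
  have mH: "A \<in> events" if "A \<in> sets H" for A using H that by (auto simp: subalgebra_def)
  have spF: "space M \<in> sets F" and spH: "space M \<in> sets H"
    using F H sets.top[of F] sets.top[of H] by (auto simp: subalgebra_def)
  have gen: "A \<inter> C \<in> sets K" if "A \<in> sets F" "C \<in> sets H" for A C
    unfolding K_sets using that by auto
  have FK: "A \<in> sets K" if "A \<in> sets F" for A
    using gen[OF that spH] sets.sets_into_space[OF mF[OF that]] by (simp add: Int_absorb2)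
  have HK: "sets H \<subseteq> sets K"
  proof
    fix C assume C: "C \<in> sets H"
    show "C \<in> sets K"
      using gen[OF spF C] sets.sets_into_space[OF mH[OF C]] by (simp add: Int_absorb1)
  qed
  have sub_HK: "subalgebra K H"
    using HK H K by (auto simp: subalgebra_def)
  have i1: "integrable M (indicator B :: 'a \<Rightarrow> real)" if "B \<in> events" for B
    using that by (simp add: integrable_real_indicator less_top[symmetric])
  have iP: "integrable M (?P B)" if "B \<in> events" for B
    by (rule H.real_cond_exp_int(1)[OF i1[OF that]])
  have iAP: "integrable M (\<lambda>x. ?P B x * indicator A x)" if "B \<in> events" "A \<in> events" for A B
    by (rule integrable_real_mult_indicator[OF that(2) iP[OF that(1)]])
  have pull: "AE \<omega> in M. real_cond_exp M H (\<lambda>x. ?P B x * indicator A x) \<omega> = ?P A \<omega> * ?P B \<omega>"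
    if "A \<in> events" "B \<in> events" for A B
  proof -
    have "AE \<omega> in M. real_cond_exp M H (\<lambda>x. ?P B x * indicator A x) \<omega> = ?P B \<omega> * ?P A \<omega>"
      by (rule H.real_cond_exp_mult) (use that iAP in auto)
    then show ?thesis by (simp add: mult.commute)
  qed
  show ?thesis
  proof
    assume product: ?product
    show ?same
    proof
      fix B assume B: "B \<in> sets G"
      let ?\<G> = "{A \<inter> C |A C. A \<in> sets F \<and> C \<in> sets H}"
      have rect: "(\<integral>x\<in>A \<inter> C. indicator B x \<partial>M) = (\<integral>x\<in>A \<inter> C. ?P B x \<partial>M)"
        if A: "A \<in> sets F" and C: "C \<in> sets H" for A C
      proof -
        have "(\<integral>x\<in>A \<inter> C. indicator B x \<partial>M) = (\<integral>x\<in>C. indicator (A \<inter> B) x \<partial>M)"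
          unfolding set_lebesgue_integral_def
          by (intro Bochner_Integration.integral_cong) (auto simp: indicator_def)
        also have "\<dots> = (\<integral>x\<in>C. ?P (A \<inter> B) x \<partial>M)"
          by (rule H.real_cond_exp_intA) (use mF[OF A] mG[OF B] C i1 in auto)
        also have "\<dots> = (\<integral>x\<in>C. real_cond_exp M H (\<lambda>x. ?P B x * indicator A x) x \<partial>M)"
        proof (rule set_lebesgue_integral_cong_AE)
          show "AE x\<in>C in M. ?P (A \<inter> B) x = real_cond_exp M H (\<lambda>x. ?P B x * indicator A x) x"
            using product[rule_format, OF A B] pull[OF mF[OF A] mG[OF B]] by eventually_elim simp
        qed (use mH[OF C] in auto)
        also have "\<dots> = (\<integral>x\<in>C. ?P B x * indicator A x \<partial>M)"
          by (rule H.real_cond_exp_intA[symmetric]) (use iAP mF[OF A] mG[OF B] C in auto)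
        also have "\<dots> = (\<integral>x\<in>A \<inter> C. ?P B x \<partial>M)"
          unfolding set_lebesgue_integral_def
          by (intro Bochner_Integration.integral_cong) (auto simp: indicator_def)
        finally show ?thesis .
      qed
      show "AE \<omega> in M. real_cond_exp M K (indicator B) \<omega> = ?P B \<omega>"
      proof (rule K.real_cond_exp_charact)
        fix A assume A: "A \<in> sets K"
        show "(\<integral>x\<in>A. indicator B x \<partial>M) = (\<integral>x\<in>A. ?P B x \<partial>M)"
        proof (rule set_integral_eq_on_sigma_sets)
          show "Int_stable ?\<G>"
          proof (rule Int_stableI)
            fix a b assume "a \<in> ?\<G>" "b \<in> ?\<G>"
            then obtain A C A' C' where "A \<in> sets F" "C \<in> sets H" "A' \<in> sets F" "C' \<in> sets H"
              and "a = A \<inter> C" "b = A' \<inter> C'" by auto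
            moreover from this have "a \<inter> b = (A \<inter> A') \<inter> (C \<inter> C')" by auto
            ultimately show "a \<inter> b \<in> ?\<G>" by blast
          qed
          show "?\<G> \<subseteq> sets M" using mF mH by auto
          show "space M \<in> ?\<G>" using spF spH by blast
          show "A \<in> sigma_sets (space M) ?\<G>" using A K_sets by simp
        qed (use rect i1 iP mG[OF B] in auto)
      next
        show "?P B \<in> borel_measurable K"
          by (rule measurable_from_subalg[OF sub_HK]) simp
      qed (use i1 iP mG[OF B] in auto)
    qed
  next
    assume same: ?same
    show ?product
    proof (intro ballI)
      fix A B assume A: "A \<in> sets F" and B: "B \<in> sets G"
      have AB: "A \<inter> B \<in> events" using mF[OF A] mG[OF B] by auto
      have "AE \<omega> in M. real_cond_exp M K (\<lambda>x. indicator A x * indicator B x) \<omega> =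
          indicator A \<omega> * real_cond_exp M K (indicator B) \<omega>"
        by (rule K.real_cond_exp_mult)
          (use FK[OF A] mG[OF B] integrable_real_mult_indicator[OF mG[OF B] i1[OF mF[OF A]]] in auto)
      then have "AE \<omega> in M. real_cond_exp M K (indicator (A \<inter> B)) \<omega> = ?P B \<omega> * indicator A \<omega>"
        using same[rule_format, OF B]
        by eventually_elim (simp add: indicator_inter_arith[abs_def])
      then have "AE \<omega> in M. real_cond_exp M H (real_cond_exp M K (indicator (A \<inter> B))) \<omega> =
          real_cond_exp M H (\<lambda>x. ?P B x * indicator A x) \<omega>"
        by (rule H.real_cond_exp_cong)
          (use iAP[OF mG[OF B] mF[OF A]] in \<open>auto intro: borel_measurable_integrable\<close>)
      moreover have "AE \<omega> in M. real_cond_exp M H (real_cond_exp M K (indicator (A \<inter> B))) \<omega> =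
          ?P (A \<inter> B) \<omega>"
        by (rule H.real_cond_exp_nested_subalg[OF K sub_HK i1[OF AB]])
      ultimately show "AE \<omega> in M. ?P (A \<inter> B) \<omega> = ?P A \<omega> * ?P B \<omega>"
        using pull[OF mF[OF A] mG[OF B]] by eventually_elim simp
    qed
  qed
qed

section \<open>Random vectors\<close>

locale random_vector = prob_space M for M :: "'a measure" +
  fixes V :: "'v set" and N :: "'v \<Rightarrow> 'b measure" and X :: "'v \<Rightarrow> 'a \<Rightarrow> 'b"
  assumes measurable_component: "v \<in> V \<Longrightarrow> X v \<in> measurable M (N v)"
begin

text \<open>
  These are the \<open>\<sigma>\<close>-algebras on which the definition of conditional independence conditions.
\<close>

definition sigma_of :: "'v set \<Rightarrow> 'a measure" where
  "sigma_of A = vimage_algebra (space M) (subvector X A) (Pi\<^sub>M A N)"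

lemma measurable_subvector:
  "A \<subseteq> V \<Longrightarrow> subvector X A \<in> measurable M (Pi\<^sub>M A N)"
  unfolding subvector_def using measurable_component by (intro measurable_restrict) auto

lemma sets_sigma_of_vimage:
  "A \<subseteq> V \<Longrightarrow> sets (sigma_of A) = {subvector X A -` E \<inter> space M |E. E \<in> sets (Pi\<^sub>M A N)}"
  unfolding sigma_of_def
  by (rule sets_vimage_algebra2) (use measurable_space[OF measurable_subvector] in auto)

definition coordinate_events :: "'v set \<Rightarrow> 'a set set" where
  "coordinate_events A = (\<Union>a\<in>A. {X a -` S \<inter> space M |S. S \<in> sets (N a)})"

lemma sets_sigma_of:
  assumes "A \<subseteq> V"
  shows "sets (sigma_of A) = sigma_sets (space M) (coordinate_events A)"
proof -
  let ?\<Omega> = "\<Pi>\<^sub>E a\<in>A. space (N a)"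
  let ?C = "{{f \<in> ?\<Omega>. f a \<in> S} |a S. a \<in> A \<and> S \<in> sets (N a)}"
  have maps: "subvector X A \<in> space M \<rightarrow> ?\<Omega>"
    using measurable_space[OF measurable_subvector[OF assms]] by (auto simp: space_PiM)
  have "sets (sigma_of A) = {subvector X A -` E \<inter> space M |E. E \<in> sigma_sets ?\<Omega> ?C}"
    unfolding sets_sigma_of_vimage[OF assms] sets_PiM_single ..
  also have "\<dots> = sigma_sets (space M) {subvector X A -` E \<inter> space M |E. E \<in> ?C}"
    by (rule sigma_sets_vimage_commute[OF maps])
  also have "{subvector X A -` E \<inter> space M |E. E \<in> ?C} = coordinate_events A"
  proof -
    have "subvector X A -` {f \<in> ?\<Omega>. f a \<in> S} \<inter> space M = X a -` S \<inter> space M" if "a \<in> A" for a S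
      using that assms measurable_space[OF measurable_component] by (auto simp: subvector_def)
    then show ?thesis
      unfolding coordinate_events_def by (auto; metis (mono_tags, lifting))
  qed
  finally show ?thesis .
qed

lemma space_sigma_of [simp]: "space (sigma_of A) = space M"
  by (simp add: sigma_of_def)

lemma subalgebra_sigma_of: "A \<subseteq> V \<Longrightarrow> subalgebra M (sigma_of A)"
  unfolding subalgebra_def sets_sigma_of_vimage using measurable_sets[OF measurable_subvector] by auto

lemma sets_sigma_of_mono:
  assumes "A \<subseteq> B" "B \<subseteq> V"
  shows "sets (sigma_of A) \<subseteq> sets (sigma_of B)"
proof -
  have "sigma_sets (space M) (coordinate_events A) \<subseteq> sigma_sets (space M) (coordinate_events B)"
    by (rule sigma_sets_subseteq) (use assms in \<open>auto simp: coordinate_events_def\<close>)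
  then show ?thesis using assms sets_sigma_of[of A] sets_sigma_of[of B] by auto
qed

text \<open>
  Intersections of an event of \<open>A\<close> with an event of \<open>C\<close> are the rectangles to which the
  characterisation of conditional independence by conditional probabilities refers.
\<close>

lemma sets_sigma_of_Un:
  assumes "A \<subseteq> V" "C \<subseteq> V"
  shows "sets (sigma_of (A \<union> C)) =
    sigma_sets (space M) {E \<inter> F |E F. E \<in> sets (sigma_of A) \<and> F \<in> sets (sigma_of C)}" (is "_ = sigma_sets _ ?\<G>")
proof
  have AC: "A \<union> C \<subseteq> V" using assms by auto
  have top: "space M \<in> sets (sigma_of B)" for B using sets.top[of "sigma_of B"] by simp
  have mono: "sets (sigma_of A) \<subseteq> sets (sigma_of (A \<union> C))" "sets (sigma_of C) \<subseteq> sets (sigma_of (A \<union> C))"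
    using sets_sigma_of_mono[OF _ AC] by auto
  show "sigma_sets (space M) ?\<G> \<subseteq> sets (sigma_of (A \<union> C))"
    using sets.sigma_sets_subset[of ?\<G> "sigma_of (A \<union> C)"] mono by auto
  have incl: "coordinate_events B \<subseteq> sets (sigma_of B)" if "B \<subseteq> V" for B
    using sets_sigma_of[OF that] by auto
  have "coordinate_events (A \<union> C) \<subseteq> ?\<G>"
  proof
    fix E assume "E \<in> coordinate_events (A \<union> C)"
    then have "E \<subseteq> space M" and "E \<in> sets (sigma_of A) \<or> E \<in> sets (sigma_of C)"
      using incl assms by (auto simp: coordinate_events_def)
    then have "E = E \<inter> space M" "E = space M \<inter> E" "E \<in> sets (sigma_of A) \<or> E \<in> sets (sigma_of C)"
      by auto
    then show "E \<in> ?\<G>" using top by blast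
  qed
  then show "sets (sigma_of (A \<union> C)) \<subseteq> sigma_sets (space M) ?\<G>"
    unfolding sets_sigma_of[OF AC] by (rule sigma_sets_subseteq)
qed

text \<open>
  Without the side conditions of \<open>triples\<close>: for empty or overlapping index sets the predicate still makes
  sense and still obeys the semigraphoid rules, which saves case distinctions later.
\<close>

definition indep :: "'v set \<Rightarrow> 'v set \<Rightarrow> 'v set \<Rightarrow> bool" where
  "indep A B C \<longleftrightarrow> cond_indep_var M (Pi\<^sub>M A N) (subvector X A) (Pi\<^sub>M B N) (subvector X B)
     (Pi\<^sub>M C N) (subvector X C)"

lemma ci_structure_iff:
  "(A, B, C) \<in> ci_structure M N V X \<longleftrightarrow> (A, B, C) \<in> triples V \<and> indep A B C"
  by (simp add: ci_structure_def indep_def)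

definition same_prob :: "'v set \<Rightarrow> 'v set \<Rightarrow> 'v set \<Rightarrow> bool" where
  "same_prob C D B \<longleftrightarrow> (\<forall>E\<in>sets (sigma_of B). AE \<omega> in M.
     real_cond_exp M (sigma_of C) (indicator E) \<omega> = real_cond_exp M (sigma_of D) (indicator E) \<omega>)"

lemma indep_iff_same_prob:
  assumes "A \<subseteq> V" "B \<subseteq> V" "C \<subseteq> V"
  shows "indep A B C \<longleftrightarrow> same_prob (A \<union> C) C B"
proof -
  have "indep A B C \<longleftrightarrow> (\<forall>E\<in>sets (sigma_of A). \<forall>F\<in>sets (sigma_of B). AE \<omega> in M.
            real_cond_exp M (sigma_of C) (indicator (E \<inter> F)) \<omega> =
            real_cond_exp M (sigma_of C) (indicator E) \<omega> * real_cond_exp M (sigma_of C) (indicator F) \<omega>)"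
    unfolding indep_def cond_indep_var_def cond_prob_given_def sets_sigma_of_vimage[OF assms(1)]
      sets_sigma_of_vimage[OF assms(2)] sigma_of_def[symmetric]
    using assms measurable_subvector by blast
  also have "\<dots> \<longleftrightarrow> same_prob (A \<union> C) C B"
    unfolding same_prob_def
    by (rule cond_indep_iff_cond_exp_eq) (use assms in \<open>auto simp: subalgebra_sigma_of sets_sigma_of_Un\<close>)
  finally show ?thesis .
qed

lemma indep_sym: "indep A B C \<Longrightarrow> indep B A C"
  unfolding indep_def cond_indep_var_def by (simp add: Int_commute mult.commute)

text \<open>
  Conditioning on the empty subvector in addition to \<open>C\<close> adds no information.
\<close>

lemma indep_empty: "A \<subseteq> V \<Longrightarrow> C \<subseteq> V \<Longrightarrow> indep A {} C"
  by (rule indep_sym) (simp add: indep_iff_same_prob same_prob_def)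

lemma indep_decomposition:
  assumes "A \<subseteq> V" "B \<subseteq> V" "C \<subseteq> V" "indep A B C" "B' \<subseteq> B"
  shows "indep A B' C"
  using assms sets_sigma_of_mono[of B' B] indep_iff_same_prob[of A B C] indep_iff_same_prob[of A B' C]
  unfolding same_prob_def by blast

text \<open>
  Since \<open>P(E | B D C) = P(E | C)\<close> is already measurable for the intermediate \<open>\<sigma>\<close>-algebra of \<open>C \<union> D\<close>, the tower
  property squeezes \<open>P(E | C D)\<close> between the two.
\<close>

lemma indep_weak_union:
  assumes V: "A \<subseteq> V" "B \<subseteq> V" "D \<subseteq> V" "C \<subseteq> V" and ind: "indep A (B \<union> D) C"
  shows "indep A B (C \<union> D)"
proof (rule indep_sym)
  interpret sigma_finite_subalgebra M "sigma_of (C \<union> D)"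
    by (intro subalgebra_is_sigma_finite subalgebra_sigma_of) (use V in auto)
  have all: "same_prob (B \<union> D \<union> C) C A"
    using indep_sym[OF ind] V by (simp add: indep_iff_same_prob)
  have "same_prob (B \<union> (C \<union> D)) (C \<union> D) A"
    unfolding same_prob_def
  proof
    fix E assume E: "E \<in> sets (sigma_of A)"
    then have "E \<in> events" using subalgebra_sigma_of[OF V(1)] by (auto simp: subalgebra_def)
    then have int: "integrable M (indicator E :: 'a \<Rightarrow> real)"
      by (simp add: integrable_real_indicator less_top[symmetric])
    let ?P = "\<lambda>S. real_cond_exp M (sigma_of S) (indicator E)"
    interpret C: sigma_finite_subalgebra M "sigma_of C"
      by (intro subalgebra_is_sigma_finite subalgebra_sigma_of) (use V in auto)
    have mono: "subalgebra (sigma_of T) (sigma_of S)" if "S \<subseteq> T" "T \<subseteq> V" for S T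
      using sets_sigma_of_mono[OF that] by (auto simp: subalgebra_def)
    have eq: "AE \<omega> in M. ?P (B \<union> D \<union> C) \<omega> = ?P C \<omega>"
      using all E by (auto simp: same_prob_def)
    then have "AE \<omega> in M. real_cond_exp M (sigma_of (C \<union> D)) (?P (B \<union> D \<union> C)) \<omega> =
        real_cond_exp M (sigma_of (C \<union> D)) (?P C) \<omega>"
      by (rule real_cond_exp_cong) auto
    moreover have "AE \<omega> in M. real_cond_exp M (sigma_of (C \<union> D)) (?P (B \<union> D \<union> C)) \<omega> = ?P (C \<union> D) \<omega>"
      by (rule real_cond_exp_nested_subalg[OF subalgebra_sigma_of mono int]) (use V in auto)
    moreover have "AE \<omega> in M. real_cond_exp M (sigma_of (C \<union> D)) (?P C) \<omega> = ?P C \<omega>"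
      by (rule real_cond_exp_F_meas)
        (use C.real_cond_exp_int(1)[OF int] V in
          \<open>auto intro!: measurable_from_subalg[OF mono[of C "C \<union> D"]]\<close>)
    ultimately have "AE \<omega> in M. ?P (B \<union> D \<union> C) \<omega> = ?P (C \<union> D) \<omega>"
      using eq by eventually_elim simp
    then show "AE \<omega> in M. ?P (B \<union> (C \<union> D)) \<omega> = ?P (C \<union> D) \<omega>"
      by (simp add: Un_ac)
  qed
  then show "indep B A (C \<union> D)"
    using V by (simp add: indep_iff_same_prob)
qed

text \<open>
  Both hypotheses are equalities of conditional probabilities of events of \<open>A\<close>, and they chain:
  \<open>P(E | D B C) = P(E | B C) = P(E | C)\<close>.
\<close>

lemma indep_contraction:
  assumes V: "A \<subseteq> V" "B \<subseteq> V" "D \<subseteq> V" "C \<subseteq> V" and B: "indep A B C" and D: "indep A D (B \<union> C)"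
  shows "indep A (B \<union> D) C"
proof (rule indep_sym)
  have 1: "same_prob (B \<union> C) C A" "same_prob (D \<union> (B \<union> C)) (B \<union> C) A"
    using indep_sym[OF B] indep_sym[OF D] V by (simp_all add: indep_iff_same_prob)
  have "same_prob (D \<union> (B \<union> C)) C A"
    unfolding same_prob_def
  proof
    fix E assume E: "E \<in> sets (sigma_of A)"
    show "AE \<omega> in M. real_cond_exp M (sigma_of (D \<union> (B \<union> C))) (indicator E) \<omega> =
        real_cond_exp M (sigma_of C) (indicator E) \<omega>"
      using 1(1)[unfolded same_prob_def, rule_format, OF E]
        1(2)[unfolded same_prob_def, rule_format, OF E] by eventually_elim simp
  qed
  then show "indep (B \<union> D) A C"
    using V by (simp add: indep_iff_same_prob Un_ac)
qed

end


section \<open>Paths in forests\<close>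

abbreviation induced :: "('v \<times> 'v) set \<Rightarrow> 'v set \<Rightarrow> ('v \<times> 'v) set" where
  "induced R W \<equiv> R \<inter> W \<times> W"

abbreviation path_in :: "('v \<times> 'v) set \<Rightarrow> 'v list \<Rightarrow> bool" where
  "path_in R p \<equiv> p \<noteq> [] \<and> distinct p \<and> successively (\<lambda>u v. (u, v) \<in> R) p"

lemma vpath_iff:
  "vpath p (with_proj G) \<longleftrightarrow> path_in (parcs G) p \<and> set p \<subseteq> pverts G"
proof -
  have "set (vwalk_arcs p) \<subseteq> parcs G \<longleftrightarrow> successively (\<lambda>u v. (u, v) \<in> parcs G) p"
    by (induction p rule: vwalk_arcs.induct) simp_all
  then show ?thesis
    by (auto simp: vpath_def vwalk_def arcs_ends_def arc_to_ends_def)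
qed

lemma rtrancl_induced_imp_path:
  assumes "(x, y) \<in> (induced R W)\<^sup>*" "y \<in> W"
  shows "\<exists>p. path_in R p \<and> hd p = x \<and> last p = y \<and> set p \<subseteq> W"
  using assms(1)
proof (induction rule: converse_rtrancl_induct)
  case base
  show ?case by (rule exI[of _ "[y]"]) (use assms(2) in auto)
next
  case (step x z)
  then obtain p where p: "path_in R p" "hd p = z" "last p = y" "set p \<subseteq> W" by blast
  show ?case
  proof (cases "x \<in> set p")
    case True
    then obtain us vs where "p = us @ x # vs" by (auto simp: in_set_conv_decomp)
    then show ?thesis
      using p by (intro exI[of _ "x # vs"]) (auto simp: successively_append_iff)
  next
    case False
    then show ?thesis
      using p step(1) by (intro exI[of _ "x # p"]) (auto simp: successively_Cons)
  qed
qed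

lemma path_imp_rtrancl_induced:
  assumes "path_in R p" "set p \<subseteq> W"
  shows "(hd p, last p) \<in> (induced R W)\<^sup>*"
  using assms
proof (induction p)
  case (Cons x p)
  show ?case
  proof (cases p)
    case (Cons y q)
    then have "(x, y) \<in> induced R W" "(y, last p) \<in> (induced R W)\<^sup>*"
      using Cons.IH Cons.prems by auto
    then show ?thesis using Cons by (auto intro: converse_rtrancl_into_rtrancl)
  qed simp
qed simp

text \<open>
  Acyclicity in the only form used below: a connection between two neighbours of \<open>c\<close> that avoids \<open>c\<close>
  would close up to a cycle through \<open>c\<close>. The conditions \<open>x \<noteq> c\<close> and \<open>y \<noteq> c\<close> keep loops from counting.
\<close>

definition branches_separated :: "('v \<times> 'v) set \<Rightarrow> bool" where
  "branches_separated R \<longleftrightarrow> (\<forall>c x y. (c, x) \<in> R \<longrightarrow> (c, y) \<in> R \<longrightarrow> x \<noteq> c \<longrightarrow> y \<noteq> c \<longrightarrow>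
     (x, y) \<in> (induced R (- {c}))\<^sup>* \<longrightarrow> x = y)"

lemma branches_separatedD:
  "\<lbrakk>branches_separated R; (c, x) \<in> R; (c, y) \<in> R; x \<noteq> c; y \<noteq> c;
    (x, y) \<in> (induced R (- {c}))\<^sup>*\<rbrakk> \<Longrightarrow> x = y"
  unfolding branches_separated_def by blast

text \<open>
  Trees of the union share no vertices, so a walk that starts in one of them stays in it. A path from \<open>x\<close>
  to \<open>y\<close> that avoids \<open>c\<close> therefore gives, together with \<open>c\<close>, a cycle inside a single tree.
\<close>

lemma disjoint_union_of_trees_branches_separated:
  assumes "disjoint_union_of_trees G" and sym: "sym (parcs G)"
  shows "branches_separated (parcs G)"
  unfolding branches_separated_def
proof (intro allI impI)
  fix c x y
  assume cx: "(c, x) \<in> parcs G" and cy: "(c, y) \<in> parcs G" and ne: "x \<noteq> c" "y \<noteq> c"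
    and xy: "(x, y) \<in> (induced (parcs G) (- {c}))\<^sup>*"
  from assms(1) obtain \<T> where \<T>: "\<forall>T\<in>\<T>. undirected_tree T"
      "\<forall>T\<in>\<T>. \<forall>T'\<in>\<T>. T \<noteq> T' \<longrightarrow> pverts T \<inter> pverts T' = {}"
    and arcs: "parcs G = (\<Union>T\<in>\<T>. parcs T)"
    unfolding disjoint_union_of_trees_def by (elim exE conjE)
  have tree: "undirected_tree T" if "T \<in> \<T>" for T using \<T>(1) that by simp
  have disj: "T = T'" if "T \<in> \<T>" "T' \<in> \<T>" "v \<in> pverts T" "v \<in> pverts T'" for T T' v
    using \<T>(2) that by auto
  have ends: "u \<in> pverts T \<and> v \<in> pverts T" if "T \<in> \<T>" "(u, v) \<in> parcs T" for T u v
  proof -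
    interpret pair_graph T using tree[OF that(1)] by (simp add: undirected_tree_def)
    show ?thesis using that(2) in_arcsD1 in_arcsD2 by auto
  qed
  have stay: "(u, v) \<in> parcs T" if "T \<in> \<T>" "u \<in> pverts T" "(u, v) \<in> parcs G" for T u v
  proof -
    from that(3) arcs obtain T' where T': "T' \<in> \<T>" "(u, v) \<in> parcs T'" by auto
    have "T' = T" using disj[OF T'(1) that(1) _ that(2)] ends[OF T'] by blast
    with T' show ?thesis by simp
  qed
  from cx obtain T where T: "T \<in> \<T>" "(c, x) \<in> parcs T" using arcs by auto
  have c: "c \<in> pverts T" and x: "x \<in> pverts T" using ends[OF T] by auto
  obtain p where p: "path_in (parcs G) p" "hd p = x" "last p = y" "set p \<subseteq> - {c}"
    using rtrancl_induced_imp_path[OF xy] ne by auto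
  have "set q \<subseteq> pverts T \<and> successively (\<lambda>u v. (u, v) \<in> parcs T) q"
    if "q \<noteq> []" "hd q \<in> pverts T" "successively (\<lambda>u v. (u, v) \<in> parcs G) q" for q
    using that
  proof (induction q)
    case (Cons u q)
    show ?case
    proof (cases q)
      case (Cons v r)
      then have "(u, v) \<in> parcs T" using stay[OF T(1)] Cons.prems by auto
      then show ?thesis using Cons Cons.IH Cons.prems ends[OF T(1)] by auto
    qed (use Cons.prems in auto)
  qed simp
  from this[of p] have pT: "set p \<subseteq> pverts T" "successively (\<lambda>u v. (u, v) \<in> parcs T) p"
    using p x by auto
  show "x = y"
  proof (rule ccontr)
    assume "x \<noteq> y"
    then have "length p \<ge> 2"
      using p by (cases p; cases "tl p") auto
    moreover have "vpath (c # p) (with_proj T)"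
      unfolding vpath_iff using p pT c T(2) by (auto simp: successively_Cons)
    moreover have "(y, c) \<in> parcs T"
      using stay[OF T(1), of y c] symD[OF sym cy] pT(1) p(1,3) last_in_set by blast
    ultimately have "undirected_cycle T (c # p)"
      using p by (auto simp: undirected_cycle_def)
    then show False using tree[OF T(1)] by (auto simp: undirected_tree_def)
  qed
qed

section \<open>Compositional semigraphoids\<close>

text \<open>
  The rules are stated for arbitrary subsets of \<open>V\<close>, except for composition, which is a closure
  hypothesis about pairwise disjoint sets.
\<close>

locale compositional_semigraphoid =
  fixes V :: "'v set" and ci :: "'v set \<Rightarrow> 'v set \<Rightarrow> 'v set \<Rightarrow> bool"
  assumes finite_V: "finite V"
    and symmetry: "\<lbrakk>A \<subseteq> V; B \<subseteq> V; C \<subseteq> V; ci A B C\<rbrakk> \<Longrightarrow> ci B A C"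
    and trivial: "\<lbrakk>A \<subseteq> V; C \<subseteq> V\<rbrakk> \<Longrightarrow> ci A {} C"
    and decomposition: "\<lbrakk>A \<subseteq> V; B \<subseteq> V; C \<subseteq> V; ci A B C; B' \<subseteq> B\<rbrakk> \<Longrightarrow> ci A B' C"
    and weak_union: "\<lbrakk>A \<subseteq> V; B \<subseteq> V; D \<subseteq> V; C \<subseteq> V; ci A (B \<union> D) C\<rbrakk> \<Longrightarrow> ci A B (C \<union> D)"
    and contraction: "\<lbrakk>A \<subseteq> V; B \<subseteq> V; D \<subseteq> V; C \<subseteq> V; ci A B C; ci A D (B \<union> C)\<rbrakk> \<Longrightarrow> ci A (B \<union> D) C"
    and composition: "\<lbrakk>A \<subseteq> V; B \<subseteq> V; D \<subseteq> V; C \<subseteq> V;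
      A \<inter> B = {}; A \<inter> D = {}; A \<inter> C = {}; B \<inter> D = {}; B \<inter> C = {}; D \<inter> C = {};
      ci A B C; ci A D C\<rbrakk> \<Longrightarrow> ci A (B \<union> D) C"
begin

text \<open>
  The arcs of the bidirected graph.
\<close>

definition edges :: "('v \<times> 'v) set" where
  "edges = {(a, b). a \<in> V \<and> b \<in> V \<and> a \<noteq> b \<and> \<not> ci {a} {b} {}}"

lemma sym_edges: "sym edges"
proof (rule symI)
  fix a b assume "(a, b) \<in> edges"
  then show "(b, a) \<in> edges"
    using symmetry[of "{b}" "{a}" "{}"] by (auto simp: edges_def)
qed

lemma sym_induced: "sym (induced edges W)"
  using sym_edges by (auto simp: sym_def)

lemma weak_union_both:
  assumes "A \<union> C1 \<subseteq> V" "B \<union> C2 \<subseteq> V" "C \<subseteq> V" "ci (A \<union> C1) (B \<union> C2) C"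
  shows "ci A B (C \<union> C1 \<union> C2)"
proof -
  have "ci (A \<union> C1) B (C \<union> C2)"
    using assms by (intro weak_union[of "A \<union> C1" B C2 C]) auto
  then have "ci B (A \<union> C1) (C \<union> C2)"
    using assms by (intro symmetry[of "A \<union> C1"]) auto
  then have "ci B A (C \<union> C2 \<union> C1)"
    using assms by (intro weak_union[of B A C1 "C \<union> C2"]) auto
  then have "ci A B (C \<union> C2 \<union> C1)"
    using assms by (intro symmetry[of B]) auto
  then show ?thesis by (simp add: Un_ac)
qed

text \<open>
  Composition, once on each side, assembles the statement from its singleton instances, which are the
  missing edges.
\<close>

lemma no_edges_imp_ci:
  assumes "A \<subseteq> V" "B \<subseteq> V" "A \<inter> B = {}" "edges \<inter> A \<times> B = {}"
  shows "ci A B {}"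
proof -
  have grow: "ci A' B' {}"
    if "\<And>b. b \<in> B' \<Longrightarrow> ci A' {b} {}" "A' \<subseteq> V" "B' \<subseteq> V" "A' \<inter> B' = {}" for A' B'
  proof -
    have "finite B'" using that(3) finite_V finite_subset by blast
    then show ?thesis
      using that
    proof (induction B')
      case empty
      then show ?case using trivial by auto
    next
      case (insert b B')
      then have "ci A' (B' \<union> {b}) {}" by (intro composition[of A' B' "{b}" "{}"]) auto
      then show ?case by simp
    qed
  qed
  have "ci {a} {b} {}" if "a \<in> A" "b \<in> B" for a b
  proof -
    have "(a, b) \<notin> edges" "a \<in> V" "b \<in> V" "a \<noteq> b" using assms that by auto
    then show ?thesis by (simp add: edges_def)
  qed
  note single = this
  have "ci B {a} {}" if "a \<in> A" for a
  proof (rule symmetry)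
    show "ci {a} B {}"
    proof (rule grow)
      show "ci {a} {b} {}" if "b \<in> B" for b using single[OF \<open>a \<in> A\<close> that] .
    qed (use assms that in auto)
  qed (use assms that in auto)
  then have "ci B A {}"
    using grow[of A B] assms(1-3) by (simp add: Int_commute)
  then show ?thesis using assms(1,2) symmetry[of B A "{}"] by simp
qed

text \<open>
  The bidirected Markov property for a condition that is divided between the two sides: vertices of the
  condition connect, so they must first be placed on the side to which they belong.
\<close>

lemma cut_imp_ci:
  assumes "A \<union> C1 \<subseteq> V" "B \<union> C2 \<subseteq> V" "(A \<union> C1) \<inter> (B \<union> C2) = {}"
    "edges \<inter> (A \<union> C1) \<times> (B \<union> C2) = {}"
  shows "ci A B (C1 \<union> C2)"
  using weak_union_both[OF assms(1,2) empty_subsetI no_edges_imp_ci[OF assms]] by simp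

text \<open>
  The vertices of \<open>S\<close> that \<open>A\<close> reaches go to the side of \<open>A\<close>, all others to the side of \<open>B\<close>; an edge across
  this division would make its far end reachable as well.
\<close>

lemma separated_imp_ci:
  assumes V: "A \<subseteq> V" "B \<subseteq> V" "S \<subseteq> V" and disj: "A \<inter> B = {}" "A \<inter> S = {}" "B \<inter> S = {}"
    and sep: "\<And>a b. a \<in> A \<Longrightarrow> b \<in> B \<Longrightarrow> (a, b) \<notin> (induced edges (A \<union> B \<union> S))\<^sup>*"
  shows "ci A B S"
proof -
  let ?r = "(induced edges (A \<union> B \<union> S))\<^sup>*"
  define K where "K = ?r `` A"
  have AK: "A \<subseteq> K"
  proof
    fix a assume "a \<in> A"
    then show "a \<in> K" unfolding K_def by (rule ImageI[OF rtrancl_refl])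
  qed
  have BK: "B \<inter> K = {}"
  proof (rule ccontr)
    assume "B \<inter> K \<noteq> {}"
    then obtain b where "b \<in> B" "b \<in> K" by blast
    then show False unfolding K_def using sep by (elim ImageE) simp
  qed
  have closed: "y \<in> K" if "(x, y) \<in> edges" "x \<in> K" "x \<in> A \<union> B \<union> S" "y \<in> A \<union> B \<union> S" for x y
  proof -
    from that(2) obtain a where "a \<in> A" "(a, x) \<in> ?r" unfolding K_def by (rule ImageE)
    moreover have "(x, y) \<in> induced edges (A \<union> B \<union> S)" using that by simp
    ultimately show ?thesis unfolding K_def by (meson ImageI rtrancl_into_rtrancl)
  qed
  have "edges \<inter> (A \<union> S \<inter> K) \<times> (B \<union> (S - K)) = {}"
  proof (rule ccontr)
    assume "\<not> ?thesis"
    then obtain x y where xy: "(x, y) \<in> edges" "x \<in> A \<union> S \<inter> K" "y \<in> B \<union> (S - K)" by auto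
    then have "x \<in> K" "y \<notin> K" using AK BK by auto
    then show False using closed[OF xy(1)] xy by blast
  qed
  then have "ci A B (S \<inter> K \<union> (S - K))"
    by (intro cut_imp_ci) (use V disj in auto)
  moreover have "S \<inter> K \<union> (S - K) = S" by blast
  ultimately show ?thesis by simp
qed

text \<open>
  The condition \<open>S\<close> can be discarded piece by piece. Let \<open>A'\<close> be the part connected to \<open>a\<close> through \<open>S\<close> and
  \<open>B'\<close> the rest. No edge joins \<open>A' \<union> a\<close> to \<open>B'\<close>, so contraction removes \<open>B'\<close>; no edge joins \<open>A'\<close> to \<open>b\<close>,
  because in a forest the edge \<open>ab\<close> is the only connection, so contraction removes \<open>A'\<close>.
\<close>

lemma edge_imp_not_ci:
  assumes forest: "branches_separated edges" and ab: "(a, b) \<in> edges"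
    and S: "S \<subseteq> V - {a, b}"
  shows "\<not> ci {a} {b} S"
proof
  assume ci_S: "ci {a} {b} S"
  have V: "a \<in> V" "b \<in> V" "a \<noteq> b" "\<not> ci {a} {b} {}" using ab by (auto simp: edges_def)
  \<comment> \<open>Connection through \<open>insert a S\<close> avoids \<open>b\<close>, so the forest property at \<open>b\<close> applies to it.\<close>
  let ?r = "(induced edges (insert a S))\<^sup>*"
  define A' where "A' = {s \<in> S. (a, s) \<in> ?r}"
  define B' where "B' = S - A'"
  have S_eq: "S = A' \<union> B'" by (auto simp: A'_def B'_def)
  have sub: "A' \<subseteq> V" "B' \<subseteq> V" using S S_eq by blast+
  have out: "a \<notin> A'" "a \<notin> B'" "b \<notin> A'" "A' \<inter> B' = {}"
    using S unfolding A'_def B'_def by blast+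
  have A'_iff: "s \<in> A' \<longleftrightarrow> s \<in> S \<and> (a, s) \<in> ?r" for s by (simp add: A'_def)
  have no1: "edges \<inter> ({a} \<union> A') \<times> ({} \<union> B') = {}"
  proof (rule ccontr)
    assume "\<not> ?thesis"
    then obtain x y where xy: "(x, y) \<in> edges" "x \<in> insert a A'" "y \<in> B'" by auto
    have y: "y \<in> S" "y \<notin> A'" using xy(3) S_eq out(4) by blast+
    have "(a, x) \<in> ?r" using xy(2) A'_iff by (elim insertE) simp_all
    moreover have "(x, y) \<in> induced edges (insert a S)" using xy(1,2) y(1) S_eq by blast
    ultimately have "(a, y) \<in> ?r" by (rule rtrancl_into_rtrancl)
    with y show False by (simp add: A'_iff)
  qed
  have no2: "edges \<inter> A' \<times> {b} = {}"
  proof (rule ccontr)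
    assume "\<not> ?thesis"
    then obtain x where x: "(x, b) \<in> edges" "x \<in> A'" by auto
    have "(a, x) \<in> (induced edges (- {b}))\<^sup>*"
    proof (rule subsetD[OF rtrancl_mono])
      show "(a, x) \<in> ?r" using x by (simp add: A'_iff)
    qed (use S V in blast)
    moreover have "(b, x) \<in> edges" "(b, a) \<in> edges"
      using symD[OF sym_edges x(1)] symD[OF sym_edges ab] by simp_all
    moreover have "x \<noteq> b" using x(2) out(3) by blast
    ultimately have "a = x"
      using V branches_separatedD[OF forest, of b a x] by simp
    then show False using x(2) out(1) by simp
  qed
  have "ci ({a} \<union> A') ({} \<union> B') {}"
    by (rule no_edges_imp_ci) (use V(1) sub out no1 in simp_all)
  then have "ci {a} B' A'"
    using weak_union_both[of "{a}" A' B' "{}" "{}"] V sub by simp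
  moreover have "ci {a} {b} (B' \<union> A')"
    using ci_S S_eq by (simp add: Un_commute)
  ultimately have "ci {a} (B' \<union> {b}) A'"
    using V sub by (intro contraction[of "{a}" B' "{b}" A']) simp_all
  then have "ci {a} {b} A'"
    using V sub decomposition[of "{a}" "B' \<union> {b}" A' "{b}"] by simp
  then have "ci {b} {a} (A' \<union> {})"
    using V sub symmetry[of "{a}" "{b}" A'] by simp
  moreover have "ci {b} A' {}"
  proof (rule symmetry)
    show "ci A' {b} {}"
      by (rule no_edges_imp_ci) (use V(2) sub out no2 in simp_all)
  qed (use V sub in auto)
  ultimately have "ci {b} (A' \<union> {a}) {}"
    using V sub by (intro contraction[of "{b}" A' "{a}" "{}"]) simp_all
  then have "ci {b} {a} {}"
    using V sub decomposition[of "{b}" "A' \<union> {a}" "{}" "{a}"] by simp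
  then have "ci {a} {b} {}"
    using V symmetry[of "{b}" "{a}" "{}"] by simp
  with V show False by simp
qed

text \<open>
  Dual decomposable transitivity, transferred from relations on triples to the predicate \<open>ci\<close>.
\<close>

definition dual_decomposable_transitive :: bool where
  "dual_decomposable_transitive \<longleftrightarrow>
     (\<forall>a\<in>V. \<forall>c\<in>V. \<forall>e\<in>V. \<forall>B D. B \<subseteq> V \<longrightarrow> D \<subseteq> V \<longrightarrow>
        distinct [a, c, e] \<longrightarrow> B \<inter> {a, c, e} = {} \<longrightarrow> D \<inter> {a, c, e} = {} \<longrightarrow> B \<inter> D = {} \<longrightarrow>
        ci ({a} \<union> B) (D \<union> {e}) (V - ({a} \<union> B \<union> {c} \<union> D \<union> {e})) \<longrightarrow>
        ci {a} {e} (V - ({a} \<union> B \<union> D \<union> {e})) \<longrightarrow>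
        ci {a} {c} (V - ({a} \<union> B \<union> {c})) \<or> ci {c} {e} (V - ({c} \<union> D \<union> {e})))"

text \<open>
  The condition \<open>S\<close> may be any set that contains the interior of the path. This freedom is what makes the
  induction work: transitivity produces conditions that contain \<open>D\<close>, respectively \<open>B\<close>, besides elements of
  \<open>S\<close>.
\<close>

lemma path_imp_not_ci:
  assumes forest: "branches_separated edges" and trans: dual_decomposable_transitive
  shows "\<lbrakk>path_in edges p; length p \<ge> 2; set p \<subseteq> V; S \<subseteq> V - {hd p, last p};
    set p \<subseteq> S \<union> {hd p, last p}\<rbrakk> \<Longrightarrow> \<not> ci {hd p} {last p} S"
proof (induction p arbitrary: S)
  case Nil
  then show ?case by simp
next
  case (Cons a p)
  then obtain c q where p: "p = c # q" by (cases p) auto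
  show ?case
  proof (cases q)
    case Nil
    then show ?thesis using Cons.prems p edge_imp_not_ci[OF forest, of a c S] by simp
  next
    case q: (Cons d q')
    let ?e = "last q"
    have path: "path_in edges (a # c # q)" "set (a # c # q) \<subseteq> V"
      and S: "S \<subseteq> V - {a, ?e}" and pS: "set (a # c # q) \<subseteq> S \<union> {a, ?e}"
      using Cons.prems p q by simp_all
    have e: "?e \<in> set q" using q by simp
    have ac: "(a, c) \<in> edges" and cd: "(c, d) \<in> edges"
      using path(1) q by simp_all
    have dist: "a \<noteq> c" "c \<noteq> ?e" "a \<noteq> ?e" "a \<noteq> d" "c \<notin> set q" "c \<noteq> d" "a \<notin> set q"
      using path(1) e q by auto
    have V: "a \<in> V" "c \<in> V" "?e \<in> V" using path(2) e by auto
    have cS: "c \<in> S" and qS: "set q \<subseteq> S \<union> {?e}" using pS dist by auto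
    have IH: "\<not> ci {c} {?e} S'" if "S' \<subseteq> V - {c, ?e}" "set q \<subseteq> S' \<union> {?e}" for S'
    proof -
      have "path_in edges p" "2 \<le> length p" "set p \<subseteq> V" "hd p = c" "last p = ?e"
        "set p \<subseteq> S' \<union> {c, ?e}"
        using path that(2) p q by auto
      then show ?thesis using Cons.IH[of S'] that(1) by simp
    qed
    let ?r = "(induced edges (- {c}))\<^sup>*"
    \<comment> \<open>\<open>K\<close> is the branch of \<open>a\<close> after deleting \<open>c\<close>; it divides the vertices outside \<open>S\<close>.\<close>
    define K where "K = {v. (a, v) \<in> ?r}"
    define Q where "Q = V - insert a (insert ?e S)"
    define B where "B = Q \<inter> K"
    define D where "D = Q - K"
    have "(d, ?e) \<in> ?r"
      using path_imp_rtrancl_induced[of q edges "- {c}"] path(1) q dist(5) by simp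
    then have "(?e, d) \<in> ?r"
      by (rule symD[OF sym_rtrancl[OF sym_induced]])
    moreover have "(a, d) \<notin> ?r"
      using branches_separatedD[OF forest symD[OF sym_edges ac] cd] dist by metis
    ultimately have eK: "?e \<notin> K"
      unfolding K_def mem_Collect_eq by (metis rtrancl_trans)
    have no: "edges \<inter> (({a} \<union> B) \<union> ((S - {c}) \<inter> K)) \<times> ((D \<union> {?e}) \<union> ((S - {c}) - K)) = {}"
    proof (rule ccontr)
      assume "\<not> ?thesis"
      then obtain x y where xy: "(x, y) \<in> edges" "x \<in> ({a} \<union> B) \<union> ((S - {c}) \<inter> K)"
        "y \<in> (D \<union> {?e}) \<union> ((S - {c}) - K)" by auto
      have "x \<in> K" "x \<noteq> c" "y \<notin> K" "y \<noteq> c"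
        using xy dist cS eK by (auto simp: B_def D_def K_def Q_def)
      then have "(a, x) \<in> ?r" "(x, y) \<in> induced edges (- {c})" using xy by (auto simp: K_def)
      then have "y \<in> K" unfolding K_def by (blast intro: rtrancl_into_rtrancl)
      with \<open>y \<notin> K\<close> show False by simp
    qed
    have "ci ({a} \<union> B) (D \<union> {?e}) (((S - {c}) \<inter> K) \<union> ((S - {c}) - K))"
      by (rule cut_imp_ci) (use no V S dist eK in \<open>auto simp: B_def D_def Q_def K_def\<close>)
    moreover have "((S - {c}) \<inter> K) \<union> ((S - {c}) - K) = V - ({a} \<union> B \<union> {c} \<union> D \<union> {?e})"
      using V S cS by (auto simp: B_def D_def Q_def)
    ultimately have cut: "ci ({a} \<union> B) (D \<union> {?e}) (V - ({a} \<union> B \<union> {c} \<union> D \<union> {?e}))"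
      by simp
    have S_eq: "S = V - ({a} \<union> B \<union> D \<union> {?e})"
      using V S by (auto simp: B_def D_def Q_def)
    show ?thesis
    proof
      assume "ci {hd (a # p)} {last (a # p)} S"
      then have "ci {a} {?e} (V - ({a} \<union> B \<union> D \<union> {?e}))"
        using p q S_eq by simp
      moreover have "B \<subseteq> V" "D \<subseteq> V" "distinct [a, c, ?e]" "B \<inter> {a, c, ?e} = {}"
        "D \<inter> {a, c, ?e} = {}" "B \<inter> D = {}"
        using dist cS by (auto simp: B_def D_def Q_def)
      ultimately have "ci {a} {c} (V - ({a} \<union> B \<union> {c})) \<or> ci {c} {?e} (V - ({c} \<union> D \<union> {?e}))"
        using trans V cut unfolding dual_decomposable_transitive_def by blast
      moreover have "\<not> ci {a} {c} (V - ({a} \<union> B \<union> {c}))"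
        by (rule edge_imp_not_ci[OF forest ac]) auto
      moreover have "\<not> ci {c} {?e} (V - ({c} \<union> D \<union> {?e}))"
        by (rule IH) (use qS S dist(5) in \<open>auto simp: D_def Q_def\<close>)
      ultimately show False by blast
    qed
  qed
qed

text \<open>
  Weak union moves all of \<open>A\<close> and \<open>B\<close> except the two end points of a connecting path into the
  condition, which then contains the interior of the path.
\<close>

lemma ci_imp_separated:
  assumes forest: "branches_separated edges" and trans: dual_decomposable_transitive
    and V: "A \<subseteq> V" "B \<subseteq> V" "S \<subseteq> V" and disj: "A \<inter> B = {}" "A \<inter> S = {}" "B \<inter> S = {}"
    and ci: "ci A B S" and a: "a \<in> A" and b: "b \<in> B"
  shows "(a, b) \<notin> (induced edges (A \<union> B \<union> S))\<^sup>*"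
proof
  assume "(a, b) \<in> (induced edges (A \<union> B \<union> S))\<^sup>*"
  then obtain p where p: "path_in edges p" "hd p = a" "last p = b" "set p \<subseteq> A \<union> B \<union> S"
    using rtrancl_induced_imp_path[of a b edges "A \<union> B \<union> S"] b by auto
  let ?S = "S \<union> (A - {a}) \<union> (B - {b})"
  have "ci {a} {b} ?S"
    by (rule weak_union_both) (use V a b ci in \<open>auto simp: insert_absorb\<close>)
  moreover have "a \<noteq> b" using a b disj by auto
  then have "length p \<ge> 2" using p by (cases p; cases "tl p") auto
  then have "\<not> ci {hd p} {last p} ?S"
    by (rule path_imp_not_ci[OF forest trans p(1)]) (use p V disj a b in auto)
  ultimately show False using p by simp
qed

end


section \<open>The conditional independence structure of a random vector\<close>

lemma separates_iff_not_connected: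
  assumes G: "parcs G \<subseteq> pverts G \<times> pverts G" and A: "A \<subseteq> pverts G" "A \<inter> C = {}"
    and B: "B \<subseteq> pverts G" "B \<inter> C = {}"
  shows "separates G A B C \<longleftrightarrow>
    (\<forall>a\<in>A. \<forall>b\<in>B. (a, b) \<notin> (induced (parcs G) (pverts G - C))\<^sup>*)"
proof (intro iffI ballI notI)
  fix a b
  assume sep: "separates G A B C" and a: "a \<in> A" and b: "b \<in> B"
    and conn: "(a, b) \<in> (induced (parcs G) (pverts G - C))\<^sup>*"
  obtain p where p: "path_in (parcs G) p" "hd p = a" "last p = b" "set p \<subseteq> pverts G - C"
    using rtrancl_induced_imp_path[OF conn] b B by auto
  then have "vpath p (with_proj G)" by (auto simp: vpath_iff)
  then have "set p \<inter> C \<noteq> {}" using sep a b p unfolding separates_def by blast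
  with p(4) show False by blast
next
  assume none: "\<forall>a\<in>A. \<forall>b\<in>B. (a, b) \<notin> (induced (parcs G) (pverts G - C))\<^sup>*"
  show "separates G A B C"
    unfolding separates_def
  proof (intro ballI allI impI notI)
    fix a b p
    assume a: "a \<in> A" and b: "b \<in> B" and p: "vpath p (with_proj G) \<and> hd p = a \<and> last p = b"
      and miss: "set p \<inter> C = {}"
    have "path_in (parcs G) p" "set p \<subseteq> pverts G - C"
      using p miss unfolding vpath_iff by blast+
    from path_imp_rtrancl_induced[OF this] p none a b show False by simp
  qed
qed

text \<open>
  Closure under composition speaks of nonempty sets only; when one of the sets is empty, composition
  is trivial.
\<close>

lemma (in random_vector) compositional_semigraphoid_indep:
  assumes "finite V" and comp: "closed_under_composition V (ci_structure M N V X)"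
  shows "compositional_semigraphoid V indep"
proof
  fix A B D C
  assume V: "A \<subseteq> V" "B \<subseteq> V" "D \<subseteq> V" "C \<subseteq> V"
    and disj: "A \<inter> B = {}" "A \<inter> D = {}" "A \<inter> C = {}" "B \<inter> D = {}" "B \<inter> C = {}" "D \<inter> C = {}"
    and ind: "indep A B C" "indep A D C"
  show "indep A (B \<union> D) C"
  proof (cases "A = {} \<or> B = {} \<or> D = {}")
    case True
    then show ?thesis using ind V indep_sym[OF indep_empty[of "B \<union> D" C]] by auto
  next
    case False
    then have "(A, B, C) \<in> ci_structure M N V X" "(A, D, C) \<in> ci_structure M N V X"
      using ind V disj by (simp_all add: ci_structure_iff triples_def)
    then have "(A, B \<union> D, C) \<in> ci_structure M N V X"
      using comp[unfolded closed_under_composition_def, rule_format, of A B D C] False V disj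
      by simp
    then show ?thesis by (simp add: ci_structure_iff)
  qed
qed (rule assms(1) | erule indep_sym |
    (rule indep_empty indep_decomposition indep_weak_union indep_contraction; assumption))+

theorem theorem6p4:
  fixes V :: "'v set" and M :: "'a measure" and N :: "'v \<Rightarrow> 'b measure"
    and X :: "'v \<Rightarrow> 'a \<Rightarrow> 'b"
  assumes "finite V"
    and "prob_space M"
    and "\<And>v. v \<in> V \<Longrightarrow> X v \<in> measurable M (N v)"
    and "closed_under_composition V (ci_structure M N V X)"
    and "closed_under_dual_decomposable_transitivity V (ci_structure M N V X)"
    and "disjoint_union_of_trees (bidirected_graph V (ci_structure M N V X))"
  shows "dual V (ci_structure M N V X) =
           graph_structure (bidirected_graph V (ci_structure M N V X)) \<and>
         bidirected_global_Markov (bidirected_graph V (ci_structure M N V X))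
           (ci_structure M N V X) \<and>
         bidirected_faithful (bidirected_graph V (ci_structure M N V X)) (ci_structure M N V X)"
proof -
  interpret random_vector M V N X
    using assms(2,3) by (simp add: random_vector_def random_vector_axioms_def)
  interpret compositional_semigraphoid V indep
    by (rule compositional_semigraphoid_indep[OF assms(1,4)])
  let ?L = "ci_structure M N V X"
  let ?G = "bidirected_graph V ?L"
  have verts: "pverts ?G = V" by (simp add: bidirected_graph_def)
  have arcs: "parcs ?G = edges"
    by (auto simp: bidirected_graph_def edges_def ci_structure_iff triples_def)
  have forest: "branches_separated edges"
    using disjoint_union_of_trees_branches_separated[OF assms(6)] sym_edges by (simp add: arcs)
  have trans: dual_decomposable_transitive
    unfolding dual_decomposable_transitive_def
  proof (intro ballI allI impI)
    fix a c e B D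
    assume V: "a \<in> V" "c \<in> V" "e \<in> V" "B \<subseteq> V" "D \<subseteq> V"
      and disj: "distinct [a, c, e]" "B \<inter> {a, c, e} = {}" "D \<inter> {a, c, e} = {}" "B \<inter> D = {}"
      and ind: "indep ({a} \<union> B) (D \<union> {e}) (V - ({a} \<union> B \<union> {c} \<union> D \<union> {e}))"
        "indep {a} {e} (V - ({a} \<union> B \<union> D \<union> {e}))"
    have "({a} \<union> B, D \<union> {e}, V - ({a} \<union> B \<union> {c} \<union> D \<union> {e})) \<in> triples V"
      "({a}, {e}, V - ({a} \<union> B \<union> D \<union> {e})) \<in> triples V"
      using V disj by (auto simp: triples_def)
    then have "({a} \<union> B, D \<union> {e}, V - ({a} \<union> B \<union> {c} \<union> D \<union> {e})) \<in> ?L"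
      "({a}, {e}, V - ({a} \<union> B \<union> D \<union> {e})) \<in> ?L"
      using ind by (simp_all only: ci_structure_iff)
    then have "({a}, {c}, V - ({a} \<union> B \<union> {c})) \<in> ?L \<or> ({c}, {e}, V - ({c} \<union> D \<union> {e})) \<in> ?L"
      using assms(5)[unfolded closed_under_dual_decomposable_transitivity_def, rule_format,
          OF V disj] by blast
    then show "indep {a} {c} (V - ({a} \<union> B \<union> {c})) \<or> indep {c} {e} (V - ({c} \<union> D \<union> {e}))"
      unfolding ci_structure_iff by blast
  qed
  have "(A, B, C) \<in> dual V ?L \<longleftrightarrow> (A, B, C) \<in> graph_structure ?G" for A B C
  proof (cases "(A, B, C) \<in> triples V")
    case True
    \<comment> \<open>Paths that avoid \<open>C\<close> are the paths inside \<open>A \<union> B \<union> S\<close> for the dual condition \<open>S\<close>.\<close>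
    let ?S = "V - (A \<union> B \<union> C)"
    have V: "A \<subseteq> V" "B \<subseteq> V" "C \<subseteq> V" and disj: "A \<inter> B = {}" "A \<inter> C = {}" "B \<inter> C = {}"
      using True by (simp_all add: triples_def)
    have W: "V - C = A \<union> B \<union> ?S" using V disj by blast
    have "(A, B, ?S) \<in> triples V" using True by (auto simp: triples_def)
    then have "(A, B, C) \<in> dual V ?L \<longleftrightarrow> indep A B ?S"
      using True by (simp add: dual_def ci_structure_iff)
    also have "\<dots> \<longleftrightarrow> (\<forall>a\<in>A. \<forall>b\<in>B. (a, b) \<notin> (induced edges (A \<union> B \<union> ?S))\<^sup>*)"
    proof
      assume ind: "indep A B ?S"
      show "\<forall>a\<in>A. \<forall>b\<in>B. (a, b) \<notin> (induced edges (A \<union> B \<union> ?S))\<^sup>*"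
        by (intro ballI ci_imp_separated[OF forest trans V(1,2) _ disj(1) _ _ ind]) auto
    next
      assume "\<forall>a\<in>A. \<forall>b\<in>B. (a, b) \<notin> (induced edges (A \<union> B \<union> ?S))\<^sup>*"
      then show "indep A B ?S"
        by (intro separated_imp_ci V(1,2) disj(1)) auto
    qed
    also have "\<dots> \<longleftrightarrow> separates ?G A B C"
    proof -
      have "parcs ?G \<subseteq> pverts ?G \<times> pverts ?G" by (auto simp: arcs verts edges_def)
      from separates_iff_not_connected[OF this, of A C B] show ?thesis
        using V disj unfolding arcs verts W by simp
    qed
    finally show ?thesis
      using True by (simp add: graph_structure_def verts)
  next
    case False
    then show ?thesis by (simp add: dual_def graph_structure_def verts)
  qed
  then have eq: "dual V ?L = graph_structure ?G"
    by (intro set_eqI) (metis prod_cases3)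
  have "dual V (graph_structure ?G) \<subseteq> ?L"
  proof
    fix t assume t: "t \<in> dual V (graph_structure ?G)"
    obtain A B C where ABC: "t = (A, B, C)" by (rule prod_cases3)
    have tr: "(A, B, C) \<in> triples V" and "(A, B, V - (A \<union> B \<union> C)) \<in> graph_structure ?G"
      using t by (simp_all add: ABC dual_def)
    then have "(A, B, V - (A \<union> B \<union> C)) \<in> dual V ?L" by (simp only: eq)
    then have "(A, B, V - (A \<union> B \<union> (V - (A \<union> B \<union> C)))) \<in> ?L" by (simp add: dual_def)
    \<comment> \<open>Duality is an involution on triples.\<close>
    moreover have "V - (A \<union> B \<union> (V - (A \<union> B \<union> C))) = C"
      using tr unfolding triples_def by blast
    ultimately show "t \<in> ?L" by (simp add: ABC)
  qed
  then show ?thesis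
    using eq by (simp add: bidirected_global_Markov_def bidirected_faithful_def verts)
qed

end
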